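(* Let $G$ be a subcubic class two graph. Then $$K_G=\bigcup\{R : R \text{ is a representative conflicting subset of } G \text{ of minimal order}\},$$ where "of minimal order" means that $|R|$ is the minimum cardinality among all representative conflicting subsets of $G$.
   Context: All graphs are finite. A graph is subcubic if every vertex has degree at most 3; a subcubic graph is class two if it has no proper 3-edge-colouring (hence it has a proper 4-edge-colouring, with colours taken from $\{0,1,2,3\}$). The resistance $r(G)$ is the minimum, over all proper 4-edge-colourings $f$ of $G$ and colours $i$, of $|f^{-1}(i)|$. A minimal colouring of $G$ is a proper 4-edge-colouring $f$ with $|f^{-1}(0)|=r(G)$. The critical subgraph of $G$ is $K_G=\{e\in E(G) : f(e)=0 \text{ for some minimal colouring } f \text{ of } G\}$. A conflicting subgraph of $G$ is a subgraph admitting no proper 3-edge-colouring; it is a minimal conflicting subgraph if removing any one of its edges yields a 3-edge-colourable graph. If $M_1,\dots,M_r$ are all minimal conflicting subgraphs of $G$, a representative conflicting subset of $G$ is a set $R\subseteq E(G)$ with $R\cap E(M_i)\neq\emptyset$ for each $i$. *)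

theory Defs imports Main begin

text \<open>
  Parallel edges are allowed and loops are not, so edges are abstract objects with a set of
  two ends.  A simple graph is the special case in which \<open>ends\<close> is injective on the edges.
\<close>

record ('v, 'e) graph =
  verts :: "'v set"
  edges :: "'e set"
  ends :: "'e \<Rightarrow> 'v set"

definition finite_graph :: "('v, 'e) graph \<Rightarrow> bool" where
  "finite_graph G \<longleftrightarrow> finite (verts G) \<and> finite (edges G) \<and>
     (\<forall>e\<in>edges G. ends G e \<subseteq> verts G \<and> card (ends G e) = 2)"

definition degree :: "('v, 'e) graph \<Rightarrow> 'v \<Rightarrow> nat" where
  "degree G v = card {e \<in> edges G. v \<in> ends G e}"

definition subcubic :: "('v, 'e) graph \<Rightarrow> bool" where
  "subcubic G \<longleftrightarrow> (\<forall>v\<in>verts G. degree G v \<le> 3)"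

text \<open>The values of a colouring outside \<open>edges G\<close> are irrelevant.\<close>

definition proper_edge_colouring :: "nat \<Rightarrow> ('v, 'e) graph \<Rightarrow> ('e \<Rightarrow> nat) \<Rightarrow> bool" where
  "proper_edge_colouring k G f \<longleftrightarrow> f ` edges G \<subseteq> {..<k} \<and>
     (\<forall>e\<in>edges G. \<forall>e'\<in>edges G. e \<noteq> e' \<and> ends G e \<inter> ends G e' \<noteq> {} \<longrightarrow> f e \<noteq> f e')"

definition edge_colourable :: "nat \<Rightarrow> ('v, 'e) graph \<Rightarrow> bool" where
  "edge_colourable k G \<longleftrightarrow> (\<exists>f. proper_edge_colouring k G f)"

definition class_two :: "('v, 'e) graph \<Rightarrow> bool" where
  "class_two G \<longleftrightarrow> \<not> edge_colourable 3 G"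

definition colour_class :: "('v, 'e) graph \<Rightarrow> ('e \<Rightarrow> nat) \<Rightarrow> nat \<Rightarrow> 'e set" where
  "colour_class G f i = {e \<in> edges G. f e = i}"

definition resistance :: "('v, 'e) graph \<Rightarrow> nat" where
  "resistance G = (LEAST n. \<exists>f. \<exists>i<4. proper_edge_colouring 4 G f \<and> n = card (colour_class G f i))"

definition minimal_colouring :: "('v, 'e) graph \<Rightarrow> ('e \<Rightarrow> nat) \<Rightarrow> bool" where
  "minimal_colouring G f \<longleftrightarrow>
     proper_edge_colouring 4 G f \<and> card (colour_class G f 0) = resistance G"

text \<open>The critical subgraph is identified with its edge set.\<close>

definition critical_subgraph :: "('v, 'e) graph \<Rightarrow> 'e set" where
  "critical_subgraph G = {e \<in> edges G. \<exists>f. minimal_colouring G f \<and> f e = 0}"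

definition subgraph :: "('v, 'e) graph \<Rightarrow> ('v, 'e) graph \<Rightarrow> bool" where
  "subgraph H G \<longleftrightarrow> finite_graph H \<and> verts H \<subseteq> verts G \<and> edges H \<subseteq> edges G \<and>
     (\<forall>e\<in>edges H. ends H e = ends G e)"

definition delete_edge :: "('v, 'e) graph \<Rightarrow> 'e \<Rightarrow> ('v, 'e) graph" where
  "delete_edge G e = G\<lparr>edges := edges G - {e}\<rparr>"

definition conflicting_subgraph :: "('v, 'e) graph \<Rightarrow> ('v, 'e) graph \<Rightarrow> bool" where
  "conflicting_subgraph G M \<longleftrightarrow> subgraph M G \<and> \<not> edge_colourable 3 M"

definition minimal_conflicting_subgraph :: "('v, 'e) graph \<Rightarrow> ('v, 'e) graph \<Rightarrow> bool" where
  "minimal_conflicting_subgraph G M \<longleftrightarrow>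
     conflicting_subgraph G M \<and> (\<forall>e\<in>edges M. edge_colourable 3 (delete_edge M e))"

definition representative_conflicting_subset :: "('v, 'e) graph \<Rightarrow> 'e set \<Rightarrow> bool" where
  "representative_conflicting_subset G R \<longleftrightarrow> R \<subseteq> edges G \<and>
     (\<forall>M. minimal_conflicting_subgraph G M \<longrightarrow> R \<inter> edges M \<noteq> {})"

definition minimal_order_representative :: "('v, 'e) graph \<Rightarrow> 'e set \<Rightarrow> bool" where
  "minimal_order_representative G R \<longleftrightarrow> representative_conflicting_subset G R \<and>
     (\<forall>R'. representative_conflicting_subset G R' \<longrightarrow> card R \<le> card R')"

end

theory Submission imports Defs begin

text \<open>
  A set of edges is representative exactly when deleting it leaves a 3-edge-colourable graph, so
  the point is that the complement \<open>R\<close> of a largest 3-edge-colourable edge set is a matching: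
  then \<open>R\<close> can serve as colour class \<open>0\<close>.  Suppose two edges \<open>uv\<close>, \<open>uw\<close> of \<open>R\<close> meet at \<open>u\<close>.  Then
  \<open>u\<close> misses two colours \<open>a\<close> and \<open>b\<close>, while by maximality \<open>v\<close> and \<open>w\<close> miss only the third
  colour \<open>c\<close>, and \<open>v \<noteq> w\<close>.  The \<open>a\<close>-\<open>c\<close> Kempe chain starting at \<open>u\<close> has only one other end,
  so it avoids \<open>v\<close> or \<open>w\<close>; switching it lets one colour \<open>uv\<close> or \<open>uw\<close> with \<open>c\<close>.
\<close>

section \<open>Partial 3-edge-colourings and the partner maps of their colours\<close>

text \<open>The colours are 1, 2, 3 so that 0 stays free for the edges outside
  \<open>F\<close>.\<close>

definition three_coloured :: "('v, 'e) graph \<Rightarrow> 'e set \<Rightarrow> ('e \<Rightarrow> nat) \<Rightarrow> bool" where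
  "three_coloured G F f \<longleftrightarrow> F \<subseteq> edges G \<and> f ` F \<subseteq> {1, 2, 3} \<and>
     (\<forall>e\<in>F. \<forall>e'\<in>F. e \<noteq> e' \<and> ends G e \<inter> ends G e' \<noteq> {} \<longrightarrow> f e \<noteq> f e')"

definition misses :: "('v, 'e) graph \<Rightarrow> 'e set \<Rightarrow> ('e \<Rightarrow> nat) \<Rightarrow> 'v \<Rightarrow> nat \<Rightarrow> bool" where
  "misses G F f x c \<longleftrightarrow> (\<forall>e\<in>F. x \<in> ends G e \<longrightarrow> f e \<noteq> c)"

text \<open>A vertex missing the colour is its own partner, which makes \<open>partner G F f c\<close> an involution.\<close>

definition partner :: "('v, 'e) graph \<Rightarrow> 'e set \<Rightarrow> ('e \<Rightarrow> nat) \<Rightarrow> nat \<Rightarrow> 'v \<Rightarrow> 'v" where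
  "partner G F f c x =
     (if misses G F f x c then x else THE y. \<exists>e\<in>F. f e = c \<and> ends G e = {x, y} \<and> x \<noteq> y)"

lemma three_coloured_unique:
  assumes "three_coloured G F f" "e \<in> F" "e' \<in> F" "x \<in> ends G e" "x \<in> ends G e'" "f e = f e'"
  shows "e = e'"
  using assms unfolding three_coloured_def by blast

lemma ends_obtain_other:
  assumes "finite_graph G" "e \<in> edges G" "x \<in> ends G e"
  obtains y where "ends G e = {x, y}" "x \<noteq> y"
proof -
  from assms have "card (ends G e) = 2" unfolding finite_graph_def by blast
  then obtain p q where "ends G e = {p, q}" "p \<noteq> q" by (auto simp: card_2_iff)
  with assms(3) that show thesis by auto
qed

lemma partner_eq:
  assumes "three_coloured G F f" "e \<in> F" "ends G e = {x, y}" "x \<noteq> y"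
  shows "partner G F f (f e) x = y"
proof -
  have "(THE y'. \<exists>e'\<in>F. f e' = f e \<and> ends G e' = {x, y'} \<and> x \<noteq> y') = y"
  proof (rule the_equality)
    show "\<exists>e'\<in>F. f e' = f e \<and> ends G e' = {x, y} \<and> x \<noteq> y" using assms by blast
  next
    fix y' assume "\<exists>e'\<in>F. f e' = f e \<and> ends G e' = {x, y'} \<and> x \<noteq> y'"
    then obtain e' where e': "e' \<in> F" "f e' = f e" "ends G e' = {x, y'}" by blast
    with assms have "e' = e" using three_coloured_unique[of G F f e' e x] by simp
    with e' assms show "y' = y" by (metis doubleton_eq_iff)
  qed
  moreover have "\<not> misses G F f x (f e)" using assms by (auto simp: misses_def)
  ultimately show ?thesis by (simp add: partner_def)
qed

lemma partner_missing: "misses G F f x c \<Longrightarrow> partner G F f c x = x"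
  by (simp add: partner_def)

lemma partner_involution:
  assumes "finite_graph G" "three_coloured G F f"
  shows "partner G F f c (partner G F f c x) = x"
proof (cases "misses G F f x c")
  case False
  then obtain e where e: "e \<in> F" "x \<in> ends G e" "f e = c" unfolding misses_def by blast
  then have "e \<in> edges G" using assms(2) unfolding three_coloured_def by blast
  then obtain y where y: "ends G e = {x, y}" "x \<noteq> y"
    using ends_obtain_other[OF assms(1)] e by metis
  have "partner G F f c x = y" using partner_eq[OF assms(2) e(1) y] e by simp
  moreover have "partner G F f c y = x"
    using partner_eq[OF assms(2) e(1), of y x] y e by (simp add: insert_commute)
  ultimately show ?thesis by simp
qed (simp add: partner_missing)

section \<open>Orbits of two involutions\<close>

fun alternate :: "('a \<Rightarrow> 'a) \<Rightarrow> ('a \<Rightarrow> 'a) \<Rightarrow> 'a \<Rightarrow> nat \<Rightarrow> 'a" where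
  "alternate p q u 0 = u"
| "alternate p q u (Suc n) = (if even n then p else q) (alternate p q u n)"

text \<open>
  The orbit of \<open>u\<close> under the two involutions is a path starting at \<open>u\<close>; it can only stop at its first
  repetition, hence has at most one further fixed point of \<open>p\<close>.
\<close>

lemma alternating_orbit_avoids:
  assumes p: "\<And>x. p (p x) = x" and q: "\<And>x. q (q x) = x"
    and u: "q u = u" and v: "p v = v" and w: "p w = w" and neq: "v \<noteq> w"
  obtains C where "u \<in> C" "p ` C \<subseteq> C" "q ` C \<subseteq> C" "v \<notin> C \<or> w \<notin> C"
proof -
  let ?x = "alternate p q u"
  \<comment> \<open>The step out of an even position is made by \<open>p\<close>, so at an odd
    position \<open>p\<close> leads back.\<close>
  have px: "p (?x n) = (if even n then ?x (Suc n) else ?x (n - 1))" for n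
    using p by (cases n) auto
  have qx: "q (?x n) = (if n = 0 then u else if odd n then ?x (Suc n) else ?x (n - 1))" for n
    using q u by (cases n) auto
  have p_closed: "p ` range ?x \<subseteq> range ?x"
    by (intro subsetI, elim imageE rangeE) (metis px rangeI)
  have q_closed: "q ` range ?x \<subseteq> range ?x"
    by (intro subsetI, elim imageE rangeE) (metis qx alternate.simps(1) rangeI)
  have "v \<notin> range ?x \<or> w \<notin> range ?x"
  proof (rule ccontr)
    assume "\<not> (v \<notin> range ?x \<or> w \<notin> range ?x)"
    then have vr: "v \<in> range ?x" and wr: "w \<in> range ?x" by auto
    \<comment> \<open>A fixed point of \<open>p\<close> makes the walk stand still: at its own
      position if \<open>p\<close> is applied next, one position earlier if \<open>p\<close> has
      just been applied.\<close>
    have stop: "\<exists>i. ?x (Suc i) = ?x i \<and> ?x i = z \<and> i \<le> n" if "p z = z" "z = ?x n" for z n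
    proof (cases "even n")
      case True
      then show ?thesis using that by (intro exI[of _ n]) simp
    next
      case False
      then obtain m where m: "n = Suc m" "even m" by (cases n) auto
      have "?x m = p z" using that(2) m p by simp
      then show ?thesis using that m by (intro exI[of _ m]) simp
    qed
    define k where "k = (LEAST i. ?x (Suc i) = ?x i)"
    have "\<exists>i. ?x (Suc i) = ?x i" using vr v stop by blast
    then have k: "?x (Suc k) = ?x k" unfolding k_def by (rule LeastI_ex)
    have least: "k \<le> i" if "?x (Suc i) = ?x i" for i
      unfolding k_def using that by (rule Least_le)
    \<comment> \<open>The points at positions up to \<open>k\<close> are closed under
      \<open>p\<close> and \<open>q\<close>: each map moves to a neighbouring position or fixes
      \<open>u\<close>, and the step beyond \<open>k\<close> stands still.\<close>
    have bounded: "\<exists>m\<le>k. ?x n = ?x m" for n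
    proof (induction n)
      case (Suc n)
      then obtain m where m: "m \<le> k" "?x n = ?x m" by blast
      have next_le: "\<exists>j\<le>k. ?x (Suc m) = ?x j"
      proof (cases "m = k")
        case True then show ?thesis using k by auto
      next
        case False then show ?thesis using m by (intro exI[of _ "Suc m"]) auto
      qed
      have "?x (Suc n) = p (?x m) \<or> ?x (Suc n) = q (?x m)" using m by simp
      moreover have "\<exists>j\<le>k. p (?x m) = ?x j"
        using px[of m] next_le m(1) by (metis diff_le_self le_trans)
      moreover have "\<exists>j\<le>k. q (?x m) = ?x j"
        using qx[of m] next_le m(1) by (metis alternate.simps(1) diff_le_self le_trans le0)
      ultimately show ?case by metis
    qed auto
    \<comment> \<open>Such a point causes a standstill at some position at most \<open>k\<close>,
      hence at \<open>k\<close> itself, which is the first one.\<close>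
    have unique: "z = ?x k" if z: "p z = z" "z \<in> range ?x" for z
    proof -
      obtain n where "n \<le> k" "z = ?x n" using z(2) bounded by blast
      with stop[OF z(1)] obtain i where "?x (Suc i) = ?x i" "?x i = z" "i \<le> k"
        using le_trans by blast
      with least[of i] show ?thesis by simp
    qed
    show False using unique v w vr wr neq by metis
  qed
  moreover have "u \<in> range ?x" using rangeI[of ?x 0] by simp
  ultimately show thesis using that p_closed q_closed by blast
qed

section \<open>Kempe switches and maximum 3-coloured edge sets\<close>

text \<open>Closure under both partner maps makes \<open>C\<close> a union of vertex sets of
  \<open>a\<close>-\<open>c\<close> Kempe chains. Swapping \<open>a\<close> and \<open>c\<close> on
  the edges that meet \<open>C\<close> stays proper, turns the missing colour \<open>a\<close> at
  \<open>u\<close> into \<open>c\<close>, and recolours no edge at \<open>v\<close>.\<close>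

lemma kempe_switch:
  assumes G: "finite_graph G" and f: "three_coloured G F f"
    and ac: "a \<in> {1, 2, 3}" "c \<in> {1, 2, 3}" "a \<noteq> c"
    and C: "partner G F f a ` C \<subseteq> C" "partner G F f c ` C \<subseteq> C"
    and u: "u \<in> C" "misses G F f u a" and v: "v \<notin> C" "misses G F f v c"
  obtains g where "three_coloured G F g" "misses G F g u c" "misses G F g v c"
proof -
  define g where "g e = (if ends G e \<inter> C = {} then f e
    else if f e = a then c else if f e = c then a else f e)" for e
  have inside: "ends G e \<subseteq> C" if e: "e \<in> F" "f e = a \<or> f e = c" "ends G e \<inter> C \<noteq> {}" for e
  proof -
    obtain x where x: "x \<in> ends G e" "x \<in> C" using e(3) by blast
    have "e \<in> edges G" using f e(1) unfolding three_coloured_def by blast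
    then obtain y where y: "ends G e = {x, y}" "x \<noteq> y"
      using ends_obtain_other[OF G] x(1) by metis
    have "partner G F f (f e) x = y" using partner_eq[OF f e(1) y] .
    then have "y \<in> C" using C x(2) e(2) by blast
    with x y show ?thesis by simp
  qed
  have "three_coloured G F g"
    unfolding three_coloured_def
  proof (intro conjI ballI impI)
    show "F \<subseteq> edges G" using f unfolding three_coloured_def by blast
    show "g ` F \<subseteq> {1, 2, 3}" using f ac unfolding three_coloured_def g_def by auto
  next
    fix e e' assume e: "e \<in> F" "e' \<in> F" "e \<noteq> e' \<and> ends G e \<inter> ends G e' \<noteq> {}"
    then have ne: "f e \<noteq> f e'" using f unfolding three_coloured_def by blast
    \<comment> \<open>A recoloured edge has both ends in \<open>C\<close>, so every adjacent edge
      meets \<open>C\<close> and undergoes the same swap.\<close>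
    have 1: "ends G e' \<inter> C \<noteq> {}" if "ends G e \<inter> C \<noteq> {}" "f e = a \<or> f e = c"
      using inside[OF e(1) that(2,1)] e(3) by blast
    have 2: "ends G e \<inter> C \<noteq> {}" if "ends G e' \<inter> C \<noteq> {}" "f e' = a \<or> f e' = c"
      using inside[OF e(2) that(2,1)] e(3) by blast
    show "g e \<noteq> g e'" using ne 1 2 ac(3) unfolding g_def by (smt (verit))
  qed
  moreover have "misses G F g u c"
    using u ac(3) unfolding misses_def g_def by auto
  moreover have "misses G F g v c"
    using v inside unfolding misses_def g_def by (smt (verit) subsetD)
  ultimately show thesis using that by blast
qed

lemma three_coloured_extend:
  assumes f: "three_coloured G F f" and e: "e \<in> edges G" "e \<notin> F" "ends G e = {x, y}"
    and c: "c \<in> {1, 2, 3}" "misses G F f x c" "misses G F f y c"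
  shows "three_coloured G (insert e F) (f(e := c))"
  using assms unfolding three_coloured_def misses_def by (auto simp: image_subset_iff)

lemma card_missed_colours:
  assumes G: "finite_graph G" "subcubic G" and f: "three_coloured G F f"
    and R: "R \<subseteq> edges G - F" "\<And>e. e \<in> R \<Longrightarrow> x \<in> ends G e" and x: "x \<in> verts G"
  shows "card R \<le> card {c \<in> {1, 2, 3}. misses G F f x c}"
proof -
  let ?I = "{e \<in> F. x \<in> ends G e}"
  have fin: "finite (edges G)" using G(1) unfolding finite_graph_def by blast
  have FE: "F \<subseteq> edges G" "f ` F \<subseteq> {1, 2, 3}" using f unfolding three_coloured_def by auto
  have finI: "finite ?I" and finR: "finite R"
    using fin FE(1) R(1) by (auto intro: finite_subset)
  have "card R + card ?I = card (R \<union> ?I)"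
    using R finI finR by (intro card_Un_disjoint[symmetric]) auto
  also have "\<dots> \<le> card {e \<in> edges G. x \<in> ends G e}"
    using R FE fin by (intro card_mono) auto
  also have "\<dots> \<le> 3" using G(2) x unfolding subcubic_def degree_def by blast
  finally have le: "card R + card ?I \<le> 3" .
  have "c \<in> f ` ?I \<or> misses G F f x c" for c unfolding misses_def by blast
  then have "card {1, 2, 3::nat} \<le> card (f ` ?I \<union> {c \<in> {1, 2, 3}. misses G F f x c})"
    using finI by (intro card_mono) auto
  also have "\<dots> \<le> card (f ` ?I) + card {c \<in> {1, 2, 3}. misses G F f x c}"
    by (rule card_Un_le)
  finally show ?thesis using le card_image_le[OF finI, of f] by simp
qed

lemma maximum_three_coloured_complement_matching:
  assumes G: "finite_graph G" "subcubic G" and f: "three_coloured G F f"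
    and max: "\<And>F' g. three_coloured G F' g \<Longrightarrow> card F' \<le> card F"
    and e: "e \<in> edges G - F" and e': "e' \<in> edges G - F" and ne: "e \<noteq> e'"
  shows "ends G e \<inter> ends G e' = {}"
proof (rule ccontr)
  assume "ends G e \<inter> ends G e' \<noteq> {}"
  then obtain u where u: "u \<in> ends G e" "u \<in> ends G e'" by blast
  obtain v where v: "ends G e = {u, v}" "u \<noteq> v" using ends_obtain_other[OF G(1)] e u by blast
  obtain w where w: "ends G e' = {u, w}" "u \<noteq> w" using ends_obtain_other[OF G(1)] e' u by blast
  have verts: "u \<in> verts G" "v \<in> verts G" "w \<in> verts G"
    using G(1) e e' v w unfolding finite_graph_def by auto
  have finF: "finite F"
    using G(1) f unfolding finite_graph_def three_coloured_def by (auto intro: finite_subset)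
  \<comment> \<open>A colour missing at both ends of \<open>d\<close> would enlarge the 3-coloured
    set \<open>F\<close>, against \<open>max\<close>.\<close>
  have no_extend: False
    if "three_coloured G F g" "d \<in> edges G - F" "ends G d = {x, y}" "c \<in> {1, 2, 3}"
      "misses G F g x c" "misses G F g y c" for g d x y c
  proof -
    have "card (insert d F) \<le> card F"
      using max[OF three_coloured_extend[OF that(1) _ _ that(3-6)]] that(2) by blast
    then show False using that(2) finF by simp
  qed
  have two: "2 \<le> card {c \<in> {1, 2, 3}. misses G F f x c}"
    if "x \<in> verts G" "x \<in> ends G e" "x \<in> ends G e'" for x
  proof -
    have "card {e, e'} \<le> card {c \<in> {1, 2, 3}. misses G F f x c}"
      by (rule card_missed_colours[OF G f]) (use that e e' in auto)
    then show ?thesis using ne by simp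
  qed
  have one: "\<exists>c\<in>{1, 2, 3}. misses G F f x c"
    if "x \<in> verts G" "d \<in> edges G - F" "x \<in> ends G d" for x d
  proof -
    have "card {d} \<le> card {c \<in> {1, 2, 3}. misses G F f x c}"
      by (rule card_missed_colours[OF G f]) (use that in auto)
    then have "{c \<in> {1, 2, 3}. misses G F f x c} \<noteq> {}"
      by (metis card.empty card_1_singleton_iff not_one_le_zero One_nat_def)
    then show ?thesis by blast
  qed
  obtain S where S: "S \<subseteq> {c \<in> {1, 2, 3}. misses G F f u c}" "card S = 2"
    using two[OF verts(1) u] by (meson obtain_subset_with_card_n)
  then obtain a b where "S = {a, b}" "a \<noteq> b" by (auto simp: card_2_iff)
  with S(1) have ab: "a \<in> {1, 2, 3}" "b \<in> {1, 2, 3}" "a \<noteq> b"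
    "misses G F f u a" "misses G F f u b"
    by blast+
  \<comment> \<open>By \<open>no_extend\<close>, \<open>v\<close> misses neither \<open>a\<close>
    nor \<open>b\<close>, so what it misses is the third colour; the same holds for
    \<open>w\<close>.\<close>
  obtain c where c: "c \<in> {1, 2, 3}" "c \<noteq> a" "misses G F f v c"
    using one[OF verts(2), of e] e v no_extend[OF f e v(1)] ab by fastforce
  have cb: "c \<noteq> b" using no_extend[OF f e v(1)] ab c by blast
  have w_c: "c' = c" if "c' \<in> {1, 2, 3}" "misses G F f w c'" for c'
  proof -
    have "c' \<noteq> a" "c' \<noteq> b" using no_extend[OF f e' w(1)] that ab by blast+
    then show ?thesis using that ab c cb by auto
  qed
  have wc: "misses G F f w c" using one[OF verts(3), of e'] e' w w_c by fastforce
  \<comment> \<open>For parallel edges this vertex would lie on two uncoloured edges and so miss two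
    colours, but only \<open>c\<close> is missing there.\<close>
  have vw: "v \<noteq> w"
  proof
    assume "v = w"
    then have "2 \<le> card {c \<in> {1, 2, 3}. misses G F f w c}" using two[OF verts(3)] v w by auto
    also have "\<dots> \<le> card {c}" using w_c by (intro card_mono) auto
    finally show False by simp
  qed
  \<comment> \<open>Missing \<open>a\<close> makes \<open>u\<close> a fixed point of the
    \<open>a\<close>-partner map, the start of its chain; missing \<open>c\<close> makes
    \<open>v\<close> and \<open>w\<close> fixed points of the \<open>c\<close>-partner map, and only
    one of them fits on the chain.\<close>
  obtain C where C: "u \<in> C" "partner G F f c ` C \<subseteq> C" "partner G F f a ` C \<subseteq> C"
      "v \<notin> C \<or> w \<notin> C"
    using alternating_orbit_avoids[of "partner G F f c" "partner G F f a" u v w]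
      partner_involution[OF G(1) f] partner_missing c(3) wc ab(4) vw by metis
  \<comment> \<open>After the switch, \<open>c\<close> is missing at \<open>u\<close> and at the
    vertex outside \<open>C\<close>, so the edge joining them can receive \<open>c\<close>.\<close>
  from C(4) show False
  proof
    assume "v \<notin> C"
    then obtain g where "three_coloured G F g" "misses G F g u c" "misses G F g v c"
      using kempe_switch[OF G(1) f ab(1) c(1)] c C ab by metis
    then show False using no_extend e v(1) c(1) by blast
  next
    assume "w \<notin> C"
    then obtain g where "three_coloured G F g" "misses G F g u c" "misses G F g w c"
      using kempe_switch[OF G(1) f ab(1) c(1)] c C ab wc by metis
    then show False using no_extend e' w(1) c(1) by blast
  qed
qed

section \<open>Representative subsets as complements of 3-edge-colourable sets\<close>

lemma edge_colourable_three_iff: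
  assumes "F \<subseteq> edges G"
  shows "edge_colourable 3 (G\<lparr>edges := F\<rparr>) \<longleftrightarrow> (\<exists>f. three_coloured G F f)"
proof
  assume "edge_colourable 3 (G\<lparr>edges := F\<rparr>)"
  then obtain f where f: "proper_edge_colouring 3 (G\<lparr>edges := F\<rparr>) f"
    unfolding edge_colourable_def by blast
  have "Suc (f e) \<in> {1, 2, 3}" if "e \<in> F" for e
  proof -
    have "f e < 3" using f that unfolding proper_edge_colouring_def by auto
    then show ?thesis by auto
  qed
  then have "three_coloured G F (\<lambda>e. Suc (f e))"
    using f assms unfolding three_coloured_def proper_edge_colouring_def by auto
  then show "\<exists>f. three_coloured G F f" by blast
next
  assume "\<exists>f. three_coloured G F f"
  then obtain f where f: "three_coloured G F f" by blast
  \<comment> \<open>Truncated subtraction identifies only 0 and 1, and 0 is not among the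
    colours.\<close>
  have inj: "inj_on (\<lambda>c. c - 1) {1, 2, 3::nat}" by (auto simp: inj_on_def)
  have range: "f e \<in> {1, 2, 3}" if "e \<in> F" for e
    using f that unfolding three_coloured_def by auto
  have "f e - 1 < 3" if "e \<in> F" for e using range[OF that] by auto
  moreover have "f e - 1 \<noteq> f e' - 1"
    if "e \<in> F" "e' \<in> F" "e \<noteq> e'" "ends G e \<inter> ends G e' \<noteq> {}" for e e'
    using inj_on_eq_iff[OF inj range[OF that(1)] range[OF that(2)]] f that
    unfolding three_coloured_def by blast
  ultimately have "proper_edge_colouring 3 (G\<lparr>edges := F\<rparr>) (\<lambda>e. f e - 1)"
    unfolding proper_edge_colouring_def by auto
  then show "edge_colourable 3 (G\<lparr>edges := F\<rparr>)" unfolding edge_colourable_def by blast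
qed

lemma edge_colourable_subset:
  assumes "edge_colourable k G" "edges H \<subseteq> edges G" "\<And>e. e \<in> edges H \<Longrightarrow> ends H e = ends G e"
  shows "edge_colourable k H"
proof -
  from assms(1) obtain f where "proper_edge_colouring k G f" unfolding edge_colourable_def by blast
  then have "proper_edge_colouring k H f"
    using assms(2,3) unfolding proper_edge_colouring_def image_subset_iff by (simp add: subset_iff)
  then show ?thesis unfolding edge_colourable_def by blast
qed

text \<open>An inclusion-minimal non-3-edge-colourable subset of \<open>F\<close>, taken with all
  vertices of \<open>G\<close>, serves as \<open>M\<close>.\<close>

lemma minimal_conflicting_subgraph_exists:
  assumes G: "finite_graph G" and F: "F \<subseteq> edges G" "\<not> edge_colourable 3 (G\<lparr>edges := F\<rparr>)"
  obtains M where "minimal_conflicting_subgraph G M" "edges M \<subseteq> F"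
proof -
  define S where "S = {F'. F' \<subseteq> F \<and> \<not> edge_colourable 3 (G\<lparr>edges := F'\<rparr>)}"
  have "finite F" using G F(1) unfolding finite_graph_def by (auto intro: finite_subset)
  then have "finite S" unfolding S_def by simp
  moreover have "F \<in> S" using F unfolding S_def by simp
  ultimately obtain F' where "F' \<in> S" "\<And>H. H \<in> S \<Longrightarrow> H \<subseteq> F' \<Longrightarrow> H = F'"
    using finite_has_minimal[of S] by blast
  then have F': "F' \<subseteq> F" "\<not> edge_colourable 3 (G\<lparr>edges := F'\<rparr>)"
    and min: "\<And>H. H \<subset> F' \<Longrightarrow> edge_colourable 3 (G\<lparr>edges := H\<rparr>)"
    unfolding S_def by auto
  have "finite F'" using F'(1) \<open>finite F\<close> by (auto intro: finite_subset)
  then have sub: "subgraph (G\<lparr>edges := F'\<rparr>) G"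
    using F'(1) F(1) G unfolding subgraph_def finite_graph_def by (simp add: subset_iff) blast
  have "edge_colourable 3 (delete_edge (G\<lparr>edges := F'\<rparr>) e)" if "e \<in> F'" for e
  proof -
    have "F' - {e} \<subset> F'" using that by blast
    then show ?thesis using min unfolding delete_edge_def by simp
  qed
  then have "minimal_conflicting_subgraph G (G\<lparr>edges := F'\<rparr>)"
    using sub F'(2) unfolding minimal_conflicting_subgraph_def conflicting_subgraph_def by simp
  then show thesis using that[of "G\<lparr>edges := F'\<rparr>"] F'(1) by simp
qed

text \<open>A 3-colouring of the complement of \<open>R\<close> restricts to any subgraph avoiding
  \<open>R\<close>; if there is none, the complement contains a minimal conflicting subgraph that
  \<open>R\<close> fails to meet.\<close>

lemma representative_iff_three_coloured:
  assumes "finite_graph G"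
  shows "representative_conflicting_subset G R \<longleftrightarrow>
    R \<subseteq> edges G \<and> (\<exists>f. three_coloured G (edges G - R) f)"
proof -
  have "edge_colourable 3 (G\<lparr>edges := edges G - R\<rparr>) \<longleftrightarrow>
      (\<forall>M. minimal_conflicting_subgraph G M \<longrightarrow> R \<inter> edges M \<noteq> {})" (is "?L \<longleftrightarrow> ?R")
  proof
    assume L: ?L
    show ?R
    proof (intro allI impI notI)
      fix M assume M: "minimal_conflicting_subgraph G M" and disj: "R \<inter> edges M = {}"
      from M have sub: "subgraph M G" and nc: "\<not> edge_colourable 3 M"
        unfolding minimal_conflicting_subgraph_def conflicting_subgraph_def by auto
      have "edge_colourable 3 M"
        using sub disj unfolding subgraph_def by (intro edge_colourable_subset[OF L]) auto
      with nc show False by blast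
    qed
  next
    assume R: ?R
    show ?L
    proof (rule ccontr)
      assume "\<not> ?L"
      then obtain M where "minimal_conflicting_subgraph G M" "edges M \<subseteq> edges G - R"
        using minimal_conflicting_subgraph_exists[OF assms, of "edges G - R"] by blast
      with R show False by blast
    qed
  qed
  then show ?thesis
    unfolding representative_conflicting_subset_def
    using edge_colourable_three_iff[of "edges G - R" G] by blast
qed

section \<open>Colour classes and representative subsets of minimal order\<close>

lemma colour_class_representative:
  assumes G: "finite_graph G" and f: "proper_edge_colouring 4 G f" and i: "i < 4"
  shows "representative_conflicting_subset G (colour_class G f i)"
proof -
  \<comment> \<open>Colour 0 takes over the name \<open>i\<close> freed by the removed class,
    leaving 1, 2, 3; for \<open>i = 0\<close> nothing changes.\<close>
  define g where "g e = (if f e = 0 then i else f e)" for e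
  have range: "g e \<in> {1, 2, 3}" if "e \<in> edges G" "f e \<noteq> i" for e
  proof -
    have "f e < 4" using f that unfolding proper_edge_colouring_def by auto
    then show ?thesis using i that(2) unfolding g_def by auto
  qed
  have "g e \<noteq> g e'" if "e \<in> edges G" "e' \<in> edges G" "e \<noteq> e'" "f e \<noteq> i" "f e' \<noteq> i"
    "ends G e \<inter> ends G e' \<noteq> {}" for e e'
  proof -
    have "f e \<noteq> f e'" using f that unfolding proper_edge_colouring_def by blast
    then show ?thesis using that(4,5) unfolding g_def by auto
  qed
  then have "three_coloured G (edges G - colour_class G f i) g"
    using range unfolding three_coloured_def colour_class_def image_subset_iff by blast
  then show ?thesis
    unfolding representative_iff_three_coloured[OF G] by (auto simp: colour_class_def)
qed

text \<open>The complement of \<open>R\<close> is a maximum 3-coloured set, so \<open>R\<close> is a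
  matching and can be given colour 0.\<close>

lemma minimal_order_representative_colour_class:
  assumes G: "finite_graph G" "subcubic G" and R: "minimal_order_representative G R"
  obtains f where "proper_edge_colouring 4 G f" "colour_class G f 0 = R"
proof -
  have fin: "finite (edges G)" using G(1) unfolding finite_graph_def by blast
  from R obtain f where RE: "R \<subseteq> edges G" and f: "three_coloured G (edges G - R) f"
    unfolding minimal_order_representative_def representative_iff_three_coloured[OF G(1)] by blast
  \<comment> \<open>The complement of any 3-coloured set is representative, so a smallest
    \<open>R\<close> has a largest complement.\<close>
  have max: "card F \<le> card (edges G - R)" if "three_coloured G F g" for F g
  proof -
    have FE: "F \<subseteq> edges G" using that unfolding three_coloured_def by blast
    then have "edges G - (edges G - F) = F" by blast
    with that have "representative_conflicting_subset G (edges G - F)"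
      unfolding representative_iff_three_coloured[OF G(1)] by auto
    then have "card R \<le> card (edges G - F)"
      using R unfolding minimal_order_representative_def by blast
    then show ?thesis
      using FE RE fin card_mono[OF fin FE] card_mono[OF fin RE]
      by (simp add: card_Diff_subset finite_subset)
  qed
  have matching: "ends G e \<inter> ends G e' = {}" if "e \<in> R" "e' \<in> R" "e \<noteq> e'" for e e'
    by (rule maximum_three_coloured_complement_matching[OF G f max]) (use that RE in auto)
  define g where "g e = (if e \<in> R then 0 else f e)" for e
  have "f e \<in> {1, 2, 3}" if "e \<in> edges G" "e \<notin> R" for e
    using f that unfolding three_coloured_def by blast
  then have range: "0 < f e" "f e < 4" if "e \<in> edges G" "e \<notin> R" for e
    using that by fastforce+
  have "g e \<noteq> g e'"
    if "e \<in> edges G" "e' \<in> edges G" "e \<noteq> e'" "ends G e \<inter> ends G e' \<noteq> {}" for e e'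
    using that f matching[of e e'] range(1)[of e] range(1)[of e']
    unfolding three_coloured_def g_def by (cases "e \<in> R"; cases "e' \<in> R") auto
  then have "proper_edge_colouring 4 G g"
    using range(2) unfolding proper_edge_colouring_def g_def by auto
  moreover have "g e = 0 \<longleftrightarrow> e \<in> R" if "e \<in> edges G" for e
    using range(1)[OF that] unfolding g_def by auto
  then have "colour_class G g 0 = R" using RE unfolding colour_class_def by blast
  ultimately show thesis using that by blast
qed

lemma minimal_order_representative_exists:
  assumes "finite_graph G"
  obtains R where "minimal_order_representative G R"
proof -
  have "representative_conflicting_subset G (edges G)"
    unfolding representative_iff_three_coloured[OF assms] three_coloured_def by simp
  then show thesis
    using that ex_has_least_nat[of "representative_conflicting_subset G" "edges G" card]
    unfolding minimal_order_representative_def by blast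
qed

text \<open>\<open>R\<close> occurs as a colour class, and every class of a proper 4-edge-colouring
  is representative, hence no smaller than \<open>R\<close>.\<close>

lemma resistance_eq_card:
  assumes G: "finite_graph G" "subcubic G" and R: "minimal_order_representative G R"
  shows "resistance G = card R"
  unfolding resistance_def
proof (rule Least_equality)
  obtain f where "proper_edge_colouring 4 G f" "colour_class G f 0 = R"
    using minimal_order_representative_colour_class[OF assms] .
  then show "\<exists>f. \<exists>i<4. proper_edge_colouring 4 G f \<and> card R = card (colour_class G f i)"
    by (metis zero_less_numeral)
next
  fix n assume "\<exists>f. \<exists>i<4. proper_edge_colouring 4 G f \<and> n = card (colour_class G f i)"
  then show "card R \<le> n"
    using colour_class_representative[OF G(1)] R
    unfolding minimal_order_representative_def by blast
qed

theorem theorem2p8: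
  fixes G :: "('v, 'e) graph"
  assumes "finite_graph G" and "subcubic G" and "class_two G"
  shows "critical_subgraph G = \<Union> {R. minimal_order_representative G R}"
proof (intro equalityI subsetI)
  fix e assume "e \<in> critical_subgraph G"
  then obtain f where e: "e \<in> colour_class G f 0" and f: "proper_edge_colouring 4 G f"
    and card_f: "card (colour_class G f 0) = resistance G"
    unfolding critical_subgraph_def minimal_colouring_def colour_class_def by blast
  obtain R where R: "minimal_order_representative G R"
    using minimal_order_representative_exists[OF assms(1)] .
  \<comment> \<open>Class 0 of a minimal colouring is representative and has exactly
    \<open>card R\<close> edges.\<close>
  have "minimal_order_representative G (colour_class G f 0)"
    using colour_class_representative[OF assms(1) f, of 0] R card_f
      resistance_eq_card[OF assms(1,2) R]
    unfolding minimal_order_representative_def by simp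
  with e show "e \<in> \<Union> {R. minimal_order_representative G R}" by blast
next
  fix e assume "e \<in> \<Union> {R. minimal_order_representative G R}"
  then obtain R where R: "minimal_order_representative G R" and e: "e \<in> R" by blast
  obtain f where f: "proper_edge_colouring 4 G f" "colour_class G f 0 = R"
    using minimal_order_representative_colour_class[OF assms(1,2) R] .
  then have "minimal_colouring G f"
    using resistance_eq_card[OF assms(1,2) R] unfolding minimal_colouring_def by simp
  with e f(2) show "e \<in> critical_subgraph G"
    unfolding critical_subgraph_def colour_class_def by auto
qed

end
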